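(* For every connected graph $H$ with at least two vertices, every connected $H$-graph $G$ satisfies $\mathsf{lpt}(G) \le 4(\mathsf{tw}(H)+1)|E(H)|$.
   Context: All graphs are finite and simple. A subdivision $H'$ of $H$ is obtained by replacing each edge $xy$ of $H$ by a path from $x$ to $y$ of length at least one, with the interiors of these paths pairwise disjoint and anticomplete. A graph $G$ is an $H$-graph if there exist a subdivision $H^{\Phi}$ of $H$ and a map $\Phi: V(G)\to 2^{V(H^{\Phi})}$ such that each $H^{\Phi}[\Phi(v)]$ is connected and, for distinct $u,v\in V(G)$, $uv\in E(G)$ iff $\Phi(u)\cap\Phi(v)\neq\emptyset$. $\mathsf{tw}(H)$ is the treewidth of $H$. A longest path of a connected graph $G$ is a path of maximum length in $G$; a longest path transversal is a set of vertices meeting every longest path; $\mathsf{lpt}(G)$ is the minimum cardinality of a longest path transversal of $G$. *)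

theory Defs
  imports Main
begin

type_synonym 'a graph = "'a set \<times> 'a set set"

definition verts :: "'a graph \<Rightarrow> 'a set" where "verts G = fst G"
definition edges :: "'a graph \<Rightarrow> 'a set set" where "edges G = snd G"

definition simple_graph :: "'a graph \<Rightarrow> bool" where
  "simple_graph G \<longleftrightarrow> finite (verts G) \<and>
     (\<forall>e\<in>edges G. \<exists>x y. x \<noteq> y \<and> x \<in> verts G \<and> y \<in> verts G \<and> e = {x, y})"

definition induced :: "'a graph \<Rightarrow> 'a set \<Rightarrow> 'a graph" where
  "induced G X = (X, {e \<in> edges G. e \<subseteq> X})"

text \<open>A path is a nonempty list of distinct vertices, consecutive ones adjacent.
  Its length is the number of edges, i.e. length of the list minus one.\<close>
definition is_path :: "'a graph \<Rightarrow> 'a list \<Rightarrow> bool" where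
  "is_path G p \<longleftrightarrow> p \<noteq> [] \<and> distinct p \<and> set p \<subseteq> verts G \<and>
     (\<forall>i. Suc i < length p \<longrightarrow> {p ! i, p ! Suc i} \<in> edges G)"

definition path_edges :: "'a list \<Rightarrow> 'a set set" where
  "path_edges p = {{p ! i, p ! Suc i} | i. Suc i < length p}"

definition interior :: "'a list \<Rightarrow> 'a set" where
  "interior p = set (butlast (tl p))"

definition connected :: "'a graph \<Rightarrow> bool" where
  "connected G \<longleftrightarrow> verts G \<noteq> {} \<and>
     (\<forall>x\<in>verts G. \<forall>y\<in>verts G. \<exists>p. is_path G p \<and> hd p = x \<and> last p = y)"

definition is_cycle :: "'a graph \<Rightarrow> 'a list \<Rightarrow> bool" where
  "is_cycle G c \<longleftrightarrow> length c \<ge> 3 \<and> is_path G c \<and> {last c, hd c} \<in> edges G"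

definition is_tree :: "'a graph \<Rightarrow> bool" where
  "is_tree T \<longleftrightarrow> simple_graph T \<and> connected T \<and> \<not> (\<exists>c. is_cycle T c)"

definition longest_path :: "'a graph \<Rightarrow> 'a list \<Rightarrow> bool" where
  "longest_path G p \<longleftrightarrow> is_path G p \<and> (\<forall>q. is_path G q \<longrightarrow> length q \<le> length p)"

definition lp_transversal :: "'a graph \<Rightarrow> 'a set \<Rightarrow> bool" where
  "lp_transversal G T \<longleftrightarrow> T \<subseteq> verts G \<and> (\<forall>p. longest_path G p \<longrightarrow> set p \<inter> T \<noteq> {})"

definition lpt :: "'a graph \<Rightarrow> nat" where
  "lpt G = (LEAST k. \<exists>T. lp_transversal G T \<and> card T = k)"

definition tree_decomposition :: "'h graph \<Rightarrow> nat graph \<Rightarrow> (nat \<Rightarrow> 'h set) \<Rightarrow> bool" where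
  "tree_decomposition H T B \<longleftrightarrow> is_tree T \<and>
     (\<forall>t\<in>verts T. B t \<subseteq> verts H) \<and>
     (\<forall>v\<in>verts H. \<exists>t\<in>verts T. v \<in> B t) \<and>
     (\<forall>e\<in>edges H. \<exists>t\<in>verts T. e \<subseteq> B t) \<and>
     (\<forall>v\<in>verts H. connected (induced T {t \<in> verts T. v \<in> B t}))"

definition td_width :: "nat graph \<Rightarrow> (nat \<Rightarrow> 'h set) \<Rightarrow> nat" where
  "td_width T B = Max ((\<lambda>t. card (B t)) ` verts T) - 1"

definition treewidth :: "'h graph \<Rightarrow> nat" where
  "treewidth H = (LEAST k. \<exists>T B. tree_decomposition H T B \<and> td_width T B = k)"

text \<open>S (on vertex type nat) is a subdivision of H: the branch vertices are the
  injective image of V(H); each edge xy of H is replaced by a path of length at least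
  one from the image of x to the image of y; interiors avoid the branch vertices and are
  pairwise disjoint; S consists exactly of these paths (so interiors of distinct paths
  are anticomplete).\<close>
definition subdivision_of :: "nat graph \<Rightarrow> 'h graph \<Rightarrow> bool" where
  "subdivision_of S H \<longleftrightarrow> simple_graph S \<and>
     (\<exists>\<iota> P. inj_on \<iota> (verts H) \<and>
        (\<forall>e\<in>edges H. is_path S (P e) \<and> length (P e) \<ge> 2 \<and>
            {hd (P e), last (P e)} = \<iota> ` e \<and> interior (P e) \<inter> \<iota> ` verts H = {}) \<and>
        (\<forall>e\<in>edges H. \<forall>f\<in>edges H. e \<noteq> f \<longrightarrow> interior (P e) \<inter> interior (P f) = {}) \<and>
        verts S = \<iota> ` verts H \<union> (\<Union>e\<in>edges H. set (P e)) \<and>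
        edges S = (\<Union>e\<in>edges H. path_edges (P e)))"

definition is_H_graph :: "'a graph \<Rightarrow> 'h graph \<Rightarrow> bool" where
  "is_H_graph G H \<longleftrightarrow> (\<exists>S \<Phi>. subdivision_of S H \<and>
     (\<forall>v\<in>verts G. \<Phi> v \<subseteq> verts S \<and> connected (induced S (\<Phi> v))) \<and>
     (\<forall>u\<in>verts G. \<forall>v\<in>verts G. u \<noteq> v \<longrightarrow> ({u, v} \<in> edges G \<longleftrightarrow> \<Phi> u \<inter> \<Phi> v \<noteq> {})))"

end

theory Submission
  imports Defs
begin

text \<open>
  Let \<open>S\<close> be the subdivision and \<open>\<Phi>\<close> the representation. Any two longest paths of \<open>G\<close> meet, so their
  traces (unions of the sets \<open>\<Phi> v\<close>) are pairwise intersecting connected sets of \<open>S\<close>.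

  The vertices whose sets contain a fixed point \<open>s\<close> of \<open>S\<close> form a clique. For each subdivided edge and
  each direction, select from it a vertex whose set reaches farthest along that edge. If \<open>s\<close> is a
  branch vertex and \<open>v\<close> is a clique vertex on a longest path, then the point shared by \<open>v\<close> and its
  successor is also covered by a selected vertex, which could be inserted into the path unless the
  path already meets the selection. So \<open>2 |E(H)|\<close> vertices hit all longest paths whose traces contain \<open>s\<close>.

  If all traces contain branch vertices, these form a bramble of \<open>H\<close>, hence some bag of an optimal tree
  decomposition of \<open>H\<close> hits all of them, giving \<open>2 (tw(H) + 1) |E(H)|\<close>. Otherwise some trace is an inner
  interval of one subdivided edge, and the two ends of this edge and one inner point hit all traces,
  giving \<open>4 |E(H)| + 2 \<le> 8 |E(H)|\<close>, which suffices as \<open>tw(H) \<ge> 1\<close>.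
\<close>

section \<open>Paths and connected vertex sets\<close>

abbreviation adj :: "'a graph \<Rightarrow> 'a \<Rightarrow> 'a \<Rightarrow> bool" where
  "adj G x y \<equiv> {x, y} \<in> edges G"

lemma adj_sym: "adj G x y \<longleftrightarrow> adj G y x"
  by (simp add: insert_commute)

lemma is_path_iff:
  "is_path G p \<longleftrightarrow> p \<noteq> [] \<and> distinct p \<and> set p \<subseteq> verts G \<and> successively (adj G) p"
  by (auto simp: is_path_def successively_conv_nth)

lemma successively_adj_rev: "successively (adj G) (rev p) \<longleftrightarrow> successively (adj G) p"
  by (simp add: successively_rev adj_sym)

lemma is_path_induced_iff:
  "is_path (induced G X) p \<longleftrightarrow> p \<noteq> [] \<and> distinct p \<and> set p \<subseteq> X \<and> successively (adj G) p"
proof -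
  have "successively (adj (induced G X)) p \<longleftrightarrow> successively (adj G) p" if "set p \<subseteq> X"
    by (rule successively_cong) (use that in \<open>auto simp: induced_def edges_def\<close>)
  thus ?thesis by (auto simp: is_path_iff induced_def verts_def)
qed

lemma connected_obtains_path:
  assumes "connected G" "x \<in> verts G" "y \<in> verts G"
  obtains p where "is_path G p" "hd p = x" "last p = y"
  using assms unfolding connected_def by blast

lemma verts_induced [simp]: "verts (induced G X) = X"
  by (simp add: induced_def verts_def)

text \<open>Connectedness as the absence of a proper nonempty subset closed under adjacency. Proofs
  can then exhibit closed subsets instead of handling paths. The empty set counts as connected,
  hence the extra conjunct in \<open>connected_induced_iff\<close>.\<close>

definition conn :: "'a graph \<Rightarrow> 'a set \<Rightarrow> bool" where
  "conn G X \<longleftrightarrow> (\<forall>Y\<subseteq>X. Y \<noteq> {} \<longrightarrow> (\<forall>y\<in>Y. \<forall>x\<in>X. adj G y x \<longrightarrow> x \<in> Y) \<longrightarrow> Y = X)"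

lemma connD:
  assumes "conn G X" "Y \<subseteq> X" "Y \<noteq> {}" "\<And>y x. y \<in> Y \<Longrightarrow> x \<in> X \<Longrightarrow> adj G y x \<Longrightarrow> x \<in> Y"
  shows "Y = X"
  using assms unfolding conn_def by blast

lemma connI:
  assumes "\<And>Y. Y \<subseteq> X \<Longrightarrow> Y \<noteq> {} \<Longrightarrow> (\<And>y x. y \<in> Y \<Longrightarrow> x \<in> X \<Longrightarrow> adj G y x \<Longrightarrow> x \<in> Y) \<Longrightarrow> X \<subseteq> Y"
  shows "conn G X"
  unfolding conn_def using assms by (meson subset_antisym)

lemma path_in_closed_set:
  assumes "successively (adj G) p" "p \<noteq> []" "hd p \<in> Y" "set p \<subseteq> X"
    and "\<And>y x. y \<in> Y \<Longrightarrow> x \<in> X \<Longrightarrow> adj G y x \<Longrightarrow> x \<in> Y"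
  shows "last p \<in> Y"
  using assms(1-4)
proof (induction p)
  case (Cons a p)
  show ?case
  proof (cases p)
    case (Cons b q)
    have "b \<in> Y" using Cons.prems Cons assms(5)[of a b] by auto
    thus ?thesis using Cons.IH Cons.prems Cons by auto
  qed (use Cons.prems in auto)
qed simp

text \<open>A path cannot leave a closed set, and conversely the set \<open>R\<close> of vertices
  reachable from \<open>x\<close> is closed.\<close>

lemma connected_induced_iff: "connected (induced G X) \<longleftrightarrow> X \<noteq> {} \<and> conn G X"
proof
  assume c: "connected (induced G X)"
  have "X \<subseteq> Y" if Y: "Y \<subseteq> X" "Y \<noteq> {}"
    and cl: "\<And>y x. y \<in> Y \<Longrightarrow> x \<in> X \<Longrightarrow> adj G y x \<Longrightarrow> x \<in> Y" for Y
  proof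
    fix x assume x: "x \<in> X"
    obtain y where y: "y \<in> Y" using Y by auto
    then obtain p where "is_path (induced G X) p" "hd p = y" "last p = x"
      using connected_obtains_path[OF c, of y x] x Y by auto
    thus "x \<in> Y" using path_in_closed_set[of G p Y X] cl y by (auto simp: is_path_induced_iff)
  qed
  thus "X \<noteq> {} \<and> conn G X"
    using c by (auto intro!: connI simp: connected_def)
next
  assume c: "X \<noteq> {} \<and> conn G X"
  have "\<exists>p. is_path (induced G X) p \<and> hd p = x \<and> last p = y" if xy: "x \<in> X" "y \<in> X" for x y
  proof -
    define R where "R = {z \<in> X. \<exists>p. is_path (induced G X) p \<and> hd p = x \<and> last p = z}"
    have "is_path (induced G X) [x]" using xy by (simp add: is_path_induced_iff)
    hence xR: "x \<in> R" using xy by (fastforce simp: R_def)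
    have "R = X"
    proof (rule connD[of G])
      fix u w assume u: "u \<in> R" and w: "w \<in> X" and uw: "adj G u w"
      obtain p where p: "is_path (induced G X) p" "hd p = x" "last p = u"
        using u by (auto simp: R_def)
      \<comment> \<open>A path that already visits \<open>w\<close> is cut off at \<open>w\<close>;
        any other path is prolonged by \<open>w\<close>.\<close>
      show "w \<in> R"
      proof (cases "w \<in> set p")
        case True
        then obtain a b where "p = (a @ [w]) @ b" by (metis append.assoc append_Cons append_Nil split_list)
        hence "is_path (induced G X) (a @ [w])" "hd (a @ [w]) = x"
          using p by (auto simp: is_path_induced_iff successively_append_iff hd_append split: if_splits)
        thus ?thesis using w unfolding R_def by fastforce
      next
        case False
        hence "is_path (induced G X) (p @ [w])" "hd (p @ [w]) = x"
          using p uw w by (auto simp: is_path_induced_iff successively_append_iff)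
        thus ?thesis using w unfolding R_def by fastforce
      qed
    qed (use c xR in \<open>auto simp: R_def\<close>)
    thus ?thesis using xy by (auto simp: R_def)
  qed
  thus "connected (induced G X)" using c by (simp add: connected_def)
qed

lemma induced_verts: "simple_graph G \<Longrightarrow> induced G (verts G) = G"
  by (auto simp: induced_def verts_def edges_def simple_graph_def prod_eq_iff)

lemma conn_verts: "simple_graph G \<Longrightarrow> connected G \<Longrightarrow> conn G (verts G)"
  by (metis connected_induced_iff induced_verts)

section \<open>Helly property of subtrees\<close>

text \<open>Common first vertices are stripped by induction. Where the paths part after
  \<open>x\<close>, the first vertex \<open>w\<close> of one that lies on the other closes a cycle
  through \<open>x\<close>.\<close>

lemma acyclic_path_unique:
  assumes acyc: "\<nexists>c. is_cycle T c"
    and "is_path T p" "is_path T q" "hd p = hd q" "last p = last q"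
  shows "p = q"
  using assms(2-)
proof (induction p arbitrary: q)
  case Nil
  then show ?case by (simp add: is_path_iff)
next
  case (Cons x p')
  then obtain q' where q: "q = x # q'"
    by (cases q) (auto simp: is_path_iff)
  show ?case
  proof (cases "p' = [] \<or> q' = []")
    case True
    then show ?thesis using Cons.prems q
      by (cases "p' = []"; cases "q' = []") (auto simp: is_path_iff)
  next
    case False
    have pq': "is_path T p'" "is_path T q'" "last p' = last q'"
      using Cons.prems q False by (auto simp: is_path_iff successively_Cons)
    show ?thesis
    proof (cases "hd p' = hd q'")
      case True
      then show ?thesis using Cons.IH[OF pq'(1,2)] pq'(3) q by simp
    next
      case ne: False
      have "\<exists>w\<in>set p'. w \<in> set q'" using False pq'(3) by (metis last_in_set)
      then obtain a w b where p': "p' = a @ w # b" "w \<in> set q'" "\<forall>y\<in>set a. y \<notin> set q'"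
        using split_list_first_prop[of p' "\<lambda>w. w \<in> set q'"] by blast
      obtain c d where q': "q' = c @ w # d" using p'(2) by (meson split_list)
      let ?c = "x # a @ w # rev c"
      \<comment> \<open>Were both \<open>a\<close> and \<open>c\<close> empty, \<open>p'\<close> and
        \<open>q'\<close> would both start with \<open>w\<close>. So the cycle has at least three
        vertices.\<close>
      have "a \<noteq> [] \<or> c \<noteq> []" using ne p' q' by auto
      hence len: "length ?c \<ge> 3" by (cases a; cases c) auto
      have xx: "successively (adj T) (x # a @ [w])" "successively (adj T) (x # c @ [w])"
        using Cons.prems q p' q'
        by (auto simp: is_path_iff successively_append_iff successively_Cons hd_append)
      have s1: "successively (adj T) (rev (x # c @ [w]))" using xx(2) by (simp only: successively_adj_rev)
      have "successively (adj T) ?c"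
        using xx(1) s1 by (auto simp: successively_append_iff successively_Cons hd_append split: if_splits)
      moreover have "distinct ?c" using Cons.prems q p' q' by (auto simp: is_path_iff)
      moreover have "set ?c \<subseteq> verts T" using Cons.prems q p' q' by (auto simp: is_path_iff)
      moreover have "adj T (last ?c) (hd ?c)"
        using s1 by (cases c) (auto simp: successively_append_iff successively_Cons last_append split: if_splits)
      ultimately have "is_cycle T ?c" using len unfolding is_cycle_def by (simp add: is_path_iff)
      thus ?thesis using acyc by blast
    qed
  qed
qed

text \<open>Root the tree at \<open>r\<close>. The vertex \<open>t\<close> of \<open>X\<close> nearest to the root is the top of the subtree
  \<open>X\<close>: the root path of any vertex of \<open>X\<close> runs through \<open>t\<close> and stays in \<open>X\<close> from there on.\<close>

lemma subtree_top:
  assumes T: "is_tree T" and r: "r \<in> verts T" and X: "X \<subseteq> verts T" "X \<noteq> {}" "conn T X"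
  obtains p where "is_path T p" "hd p = r" "last p \<in> X"
    "\<And>z q. z \<in> X \<Longrightarrow> is_path T q \<Longrightarrow> hd q = r \<Longrightarrow> last q = z \<Longrightarrow>
       \<exists>m. q = p @ m \<and> set m \<subseteq> X"
proof -
  have acyc: "\<nexists>c. is_cycle T c" and con: "connected T" using T by (auto simp: is_tree_def)
  let ?P = "\<lambda>p. is_path T p \<and> hd p = r \<and> last p \<in> X"
  obtain x where "x \<in> X" "x \<in> verts T" using X by blast
  then obtain p0 where "?P p0" using connected_obtains_path[OF con r] by metis
  \<comment> \<open>A shortest path from the root to \<open>X\<close> meets \<open>X\<close> in its
    last vertex only, so a path inside \<open>X\<close> can be appended to it.\<close>
  then obtain p where p: "?P p" and min: "\<And>q. ?P q \<Longrightarrow> length p \<le> length q"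
    using ex_has_least_nat[of ?P p0 length] by blast
  obtain a t where at: "p = a @ [t]" using p by (metis is_path_iff append_butlast_last_id)
  have t: "t \<in> X" using p at by auto
  have disj: "set a \<inter> X = {}"
  proof (rule ccontr)
    assume "set a \<inter> X \<noteq> {}"
    then obtain z where "z \<in> set a" "z \<in> X" by auto
    then obtain b c where a: "a = (b @ [z]) @ c" by (metis append.assoc append_Cons append_Nil split_list)
    hence "?P (b @ [z])" using p at \<open>z \<in> X\<close>
      by (auto simp: is_path_iff successively_append_iff hd_append split: if_splits)
    thus False using min at a by fastforce
  qed
  have "\<exists>m. q = p @ m \<and> set m \<subseteq> X"
    if z: "z \<in> X" and q: "is_path T q" "hd q = r" "last q = z" for z q
  proof -
    obtain s where s: "is_path (induced T X) s" "hd s = t" "last s = z"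
      using connected_obtains_path[of "induced T X" t z] X z t by (auto simp: connected_induced_iff)
    then obtain m where m: "s = t # m" by (cases s) (auto simp: is_path_iff)
    have "is_path T (p @ m)"
      using s(1) m p at disj X unfolding is_path_induced_iff
      by (auto simp: is_path_iff successively_append_iff successively_Cons)
    moreover have "hd (p @ m) = r" "last (p @ m) = z" using s m p at by (auto simp: hd_append)
    ultimately have "q = p @ m" using acyclic_path_unique[OF acyc q(1)] q by simp
    thus ?thesis using s m by (auto simp: is_path_induced_iff)
  qed
  thus ?thesis using that p by blast
qed

text \<open>The deepest top, that of \<open>X\<close>, lies in every \<open>Y\<close>: the root path
  to a common vertex of \<open>X\<close> and \<open>Y\<close> passes both tops, that of
  \<open>Y\<close> no later, and stays in \<open>Y\<close> from there on.\<close>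

lemma subtree_helly:
  assumes T: "is_tree T"
    and F: "\<And>X. X \<in> F \<Longrightarrow> X \<subseteq> verts T \<and> X \<noteq> {} \<and> conn T X"
    and meet: "\<And>X Y. X \<in> F \<Longrightarrow> Y \<in> F \<Longrightarrow> X \<inter> Y \<noteq> {}"
  shows "\<exists>t\<in>verts T. \<forall>X\<in>F. t \<in> X"
proof (cases "F = {}")
  case True
  then show ?thesis using T by (auto simp: is_tree_def connected_def)
next
  case False
  have con: "connected T" using T by (auto simp: is_tree_def)
  then obtain r where r: "r \<in> verts T" by (auto simp: connected_def)
  have fin: "finite F"
    using F T by (auto intro: finite_subset[of F "Pow (verts T)"] simp: is_tree_def simple_graph_def)
  define top where "top X p \<longleftrightarrow> is_path T p \<and> hd p = r \<and> last p \<in> X \<and>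
    (\<forall>z q. z \<in> X \<longrightarrow> is_path T q \<longrightarrow> hd q = r \<longrightarrow> last q = z \<longrightarrow> (\<exists>m. q = p @ m \<and> set m \<subseteq> X))" for X p
  have "\<exists>p. top X p" if "X \<in> F" for X
    using subtree_top[OF T r, of X] F[OF that] unfolding top_def by metis
  then obtain p where p: "\<And>X. X \<in> F \<Longrightarrow> top X (p X)" by metis
  define N where "N = Max ((\<lambda>X. length (p X)) ` F)"
  have "N \<in> (\<lambda>X. length (p X)) ` F" unfolding N_def using fin False by (intro Max_in) auto
  then obtain X where X: "X \<in> F" and NX: "length (p X) = N" by auto
  have max: "length (p Y) \<le> length (p X)" if "Y \<in> F" for Y
    unfolding NX N_def using fin that by (intro Max_ge) auto
  have "last (p X) \<in> Y" if Y: "Y \<in> F" for Y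
  proof -
    obtain z where z: "z \<in> X" "z \<in> Y" using meet[OF X Y] by auto
    then obtain q where q: "is_path T q" "hd q = r" "last q = z"
      using connected_obtains_path[OF con r, of z] F[OF X] by blast
    obtain m where m: "q = p X @ m" using p[OF X] z q unfolding top_def by blast
    obtain m' where m': "q = p Y @ m'" "set m' \<subseteq> Y" using p[OF Y] z q unfolding top_def by blast
    \<comment> \<open>The stretch of the root path from the top of \<open>Y\<close>, exclusive, to
      the top of \<open>X\<close>.\<close>
    define d where "d = drop (length (p Y)) (p X)"
    have "take (length (p Y)) q = p Y" using m'(1) by simp
    moreover have "take (length (p Y)) q = take (length (p Y)) (p X)" using m max[OF Y] by simp
    ultimately have d: "p X = p Y @ d" by (metis append_take_drop_id d_def)
    hence "set d \<subseteq> Y" using m m' by auto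
    have "last (p Y) \<in> Y" using p[OF Y] by (simp add: top_def)
    thus ?thesis using d \<open>set d \<subseteq> Y\<close> by (cases "d = []") auto
  qed
  moreover have "last (p X) \<in> verts T"
    using p[OF X] F[OF X] by (auto simp: top_def)
  ultimately show ?thesis by blast
qed

section \<open>Treewidth and brambles\<close>

text \<open>The decomposition with the single bag \<open>verts H\<close> shows that the minimum is
  taken over a nonempty set.\<close>

lemma treewidth_attained:
  assumes "simple_graph H"
  obtains T B where "tree_decomposition H T B" "td_width T B = treewidth H"
proof -
  let ?T = "({0}, {}) :: nat graph" and ?B = "\<lambda>_::nat. verts H"
  have c: "connected (induced ?T {0})"
    unfolding connected_induced_iff by (auto simp: conn_def)
  have s: "simple_graph ?T" by (simp add: simple_graph_def verts_def edges_def)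
  have "connected ?T" using c s by (simp add: induced_def edges_def)
  moreover have "\<not> is_cycle ?T c" for c by (simp add: is_cycle_def edges_def)
  ultimately have "is_tree ?T" using s by (simp add: is_tree_def)
  moreover have "e \<subseteq> verts H" if "e \<in> edges H" for e
    using assms that by (auto simp: simple_graph_def)
  ultimately have "tree_decomposition H ?T ?B"
    using c by (simp add: tree_decomposition_def verts_def)
  hence "\<exists>k T B. tree_decomposition H T B \<and> td_width T B = k" by blast
  hence "\<exists>T B. tree_decomposition H T B \<and> td_width T B = treewidth H"
    unfolding treewidth_def by (rule LeastI_ex)
  thus ?thesis using that by blast
qed

lemma card_bag_le:
  assumes "tree_decomposition H T B" "t \<in> verts T"
  shows "card (B t) \<le> td_width T B + 1"
proof -
  have "finite (verts T)" using assms by (auto simp: tree_decomposition_def is_tree_def simple_graph_def)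
  hence "card (B t) \<le> Max ((\<lambda>t. card (B t)) ` verts T)" using assms by (intro Max_ge) auto
  \<comment> \<open>Truncated subtraction does no harm: M \<le> (M - 1) + 1 also for M = 0.\<close>
  thus ?thesis by (simp add: td_width_def)
qed

lemma treewidth_ge_1:
  assumes H: "simple_graph H" and e: "e \<in> edges H"
  shows "treewidth H \<ge> 1"
proof -
  obtain T B where TB: "tree_decomposition H T B" "td_width T B = treewidth H"
    using treewidth_attained[OF H] .
  obtain t where t: "t \<in> verts T" "e \<subseteq> B t" using TB e by (auto simp: tree_decomposition_def)
  have "finite (B t)" using TB t H
    by (meson finite_subset simple_graph_def tree_decomposition_def)
  hence "card e \<le> card (B t)" using t by (simp add: card_mono)
  moreover have "card e = 2" using H e by (auto simp: simple_graph_def)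
  ultimately show ?thesis using card_bag_le[OF TB(1) t(1)] TB(2) by simp
qed

text \<open>Each vertex of \<open>X\<close> has a subtree of bags, and adjacent vertices share a
  bag. So a closed set \<open>Y\<close> of nodes absorbs whole subtrees, and the set
  \<open>Z\<close> of vertices of \<open>X\<close> in its bags is closed in
  \<open>X\<close>.\<close>

lemma bags_meeting_conn:
  assumes TB: "tree_decomposition H T B" and X: "X \<subseteq> verts H" "conn H X"
  shows "conn T {t \<in> verts T. B t \<inter> X \<noteq> {}}"
proof (rule connI)
  fix Y assume Y: "Y \<subseteq> {t \<in> verts T. B t \<inter> X \<noteq> {}}" "Y \<noteq> {}"
    and cl: "\<And>y x. y \<in> Y \<Longrightarrow> x \<in> {t \<in> verts T. B t \<inter> X \<noteq> {}} \<Longrightarrow> adj T y x \<Longrightarrow> x \<in> Y"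
  define Z where "Z = {x \<in> X. \<exists>t\<in>Y. x \<in> B t}"
  have sub: "{t \<in> verts T. x \<in> B t} \<subseteq> Y" if x: "x \<in> Z" for x
  proof -
    have "conn T {t \<in> verts T. x \<in> B t}"
      using TB X x by (auto simp: tree_decomposition_def connected_induced_iff Z_def)
    hence "{t \<in> verts T. x \<in> B t} \<inter> Y = {t \<in> verts T. x \<in> B t}"
      by (rule connD) (use x Y cl in \<open>auto simp: Z_def\<close>)
    thus ?thesis by blast
  qed
  have "Z = X"
  proof (rule connD[OF X(2)])
    fix x x' assume x: "x \<in> Z" "x' \<in> X" "adj H x x'"
    then obtain t where "t \<in> verts T" "{x, x'} \<subseteq> B t"
      using TB unfolding tree_decomposition_def by blast
    thus "x' \<in> Z" using sub[OF x(1)] x by (auto simp: Z_def)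
  qed (use Y in \<open>auto simp: Z_def\<close>)
  thus "{t \<in> verts T. B t \<inter> X \<noteq> {}} \<subseteq> Y" using sub by blast
qed

text \<open>The easy direction of the duality of brambles and treewidth: touching sets yield
  intersecting subtrees of nodes, and by the Helly property some node lies in all of them; its bag
  is \<open>K\<close>.\<close>

lemma bramble_hitting_set:
  assumes H: "simple_graph H"
    and F: "\<And>X. X \<in> F \<Longrightarrow> X \<subseteq> verts H \<and> X \<noteq> {} \<and> conn H X"
    and touch: "\<And>X Y. X \<in> F \<Longrightarrow> Y \<in> F \<Longrightarrow> \<exists>x\<in>X. \<exists>y\<in>Y. x = y \<or> adj H x y"
  obtains K where "K \<subseteq> verts H" "card K \<le> treewidth H + 1" "\<And>X. X \<in> F \<Longrightarrow> X \<inter> K \<noteq> {}"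
proof -
  obtain T B where TB: "tree_decomposition H T B" "td_width T B = treewidth H"
    using treewidth_attained[OF H] .
  let ?S = "\<lambda>X. {t \<in> verts T. B t \<inter> X \<noteq> {}}"
  have vcov: "\<And>v. v \<in> verts H \<Longrightarrow> \<exists>t\<in>verts T. v \<in> B t"
    and ecov: "\<And>e. e \<in> edges H \<Longrightarrow> \<exists>t\<in>verts T. e \<subseteq> B t"
    using TB(1) unfolding tree_decomposition_def by blast+
  have "\<exists>t\<in>verts T. \<forall>Z\<in>?S ` F. t \<in> Z"
  proof (rule subtree_helly)
    show "is_tree T" using TB by (simp add: tree_decomposition_def)
    show "Z \<subseteq> verts T \<and> Z \<noteq> {} \<and> conn T Z" if Z: "Z \<in> ?S ` F" for Z
    proof -
      obtain X where X: "X \<in> F" "Z = ?S X" using Z by auto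
      obtain x where "x \<in> X" "x \<in> verts H" using F[OF X(1)] by blast
      then show ?thesis using vcov[of x] X bags_meeting_conn[OF TB(1), of X] F[OF X(1)] by auto
    qed
    show "Z \<inter> W \<noteq> {}" if ZW: "Z \<in> ?S ` F" "W \<in> ?S ` F" for Z W
    proof -
      obtain X Y where X: "X \<in> F" "Z = ?S X" and Y: "Y \<in> F" "W = ?S Y" using ZW by auto
      obtain x y where xy: "x \<in> X" "y \<in> Y" "x = y \<or> adj H x y" using touch X Y by blast
      have "x \<in> verts H" using xy F X by blast
      hence "\<exists>t\<in>verts T. x \<in> B t \<and> y \<in> B t" using xy(3) vcov[of x] ecov[of "{x, y}"] by auto
      thus ?thesis using X Y xy by blast
    qed
  qed
  then obtain t where t: "t \<in> verts T" "\<forall>X\<in>F. B t \<inter> X \<noteq> {}" by auto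
  show ?thesis
  proof (rule that)
    show "B t \<subseteq> verts H" using TB t by (auto simp: tree_decomposition_def)
    show "card (B t) \<le> treewidth H + 1" using card_bag_le[OF TB(1) t(1)] TB(2) by simp
  qed (use t in blast)
qed

section \<open>Longest paths\<close>

text \<open>The longer side of \<open>u\<close> is kept, reversed if it starts at \<open>u\<close>.
  The \<open>+ 1\<close> arises because \<open>u\<close> counts for both sides.\<close>

lemma path_half:
  assumes "is_path G p" "u \<in> set p"
  obtains q where "is_path G (q @ [u])" "set (q @ [u]) \<subseteq> set p" "2 * length (q @ [u]) \<ge> length p + 1"
proof -
  obtain a b where p: "p = a @ u # b" using assms by (meson split_list)
  have s: "successively (adj G) (rev (u # b))"
    using assms p unfolding successively_adj_rev by (simp add: is_path_iff successively_append_iff)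
  show ?thesis
  proof (cases "length a \<ge> length b")
    case True
    show ?thesis by (rule that[of a])
        (use assms p True in \<open>auto simp: is_path_iff successively_append_iff\<close>)
  next
    case False
    show ?thesis by (rule that[of "rev b"])
        (use assms p False s in \<open>auto simp: is_path_iff\<close>)
  qed
qed

text \<open>If they were disjoint, joining the longer halves of both by a link would give a longer
  path.\<close>

lemma longest_paths_meet:
  assumes con: "connected G" and p: "longest_path G p" and q: "longest_path G q"
  shows "set p \<inter> set q \<noteq> {}"
proof
  assume dis: "set p \<inter> set q = {}"
  have pp: "is_path G p" "is_path G q" using p q by (auto simp: longest_path_def)
  hence "hd p \<in> verts G" "hd q \<in> verts G" by (auto simp: is_path_iff)
  then obtain R where R: "is_path G R" "hd R = hd p" "last R = hd q"
    using connected_obtains_path[OF con] by metis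
  have ne: "p \<noteq> []" "q \<noteq> []" "R \<noteq> []" using pp R by (auto simp: is_path_iff)
  have "\<exists>x\<in>set R. x \<in> set p" using R ne by (metis hd_in_set)
  \<comment> \<open>The last vertex \<open>u\<close> of \<open>R\<close> on \<open>p\<close> and the
    first later vertex \<open>w\<close> on \<open>q\<close> bound a link whose inner vertices avoid
    both paths.\<close>
  then obtain a u b where R1: "R = a @ u # b" "u \<in> set p" "\<forall>z\<in>set b. z \<notin> set p"
    using split_list_last_prop[of R "\<lambda>x. x \<in> set p"] by blast
  have "b \<noteq> []" using R1 R ne dis by (metis disjoint_iff hd_in_set last_snoc)
  hence "last b \<in> set b" "last b = last R" using R1 by auto
  hence "last b \<in> set b" "last b \<in> set q" using R ne by auto
  hence "\<exists>x\<in>set b. x \<in> set q" by blast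
  then obtain c w d where b: "b = c @ w # d" "w \<in> set q" "\<forall>z\<in>set c. z \<notin> set q"
    using split_list_first_prop[of b "\<lambda>x. x \<in> set q"] by blast
  obtain p' where p': "is_path G (p' @ [u])" "set (p' @ [u]) \<subseteq> set p" "2 * length (p' @ [u]) \<ge> length p + 1"
    using path_half[OF pp(1) R1(2)] .
  obtain q' where q': "is_path G (q' @ [w])" "set (q' @ [w]) \<subseteq> set q" "2 * length (q' @ [w]) \<ge> length q + 1"
    using path_half[OF pp(2) b(2)] .
  have sw: "successively (adj G) (rev (q' @ [w]))"
    using q' unfolding successively_adj_rev by (simp add: is_path_iff)
  let ?r = "p' @ u # c @ w # rev q'"
  have mid: "successively (adj G) (u # c @ [w])" "distinct (u # c @ [w])" "set (u # c @ [w]) \<subseteq> verts G"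
    using R R1 b by (auto simp: is_path_iff successively_append_iff successively_Cons hd_append)
  have "successively (adj G) ?r"
    using mid sw p' by (auto simp: is_path_iff successively_append_iff successively_Cons hd_append split: if_splits)
  moreover have "distinct ?r"
    using mid p' q' dis R1 b by (auto simp: is_path_iff)
  moreover have "set ?r \<subseteq> verts G" using mid p' q' by (auto simp: is_path_iff)
  ultimately have "is_path G ?r" by (simp add: is_path_iff)
  hence "length ?r \<le> length p" using p unfolding longest_path_def by blast
  \<comment> \<open>If both have n vertices, each half has at least (n + 1) / 2, so
    \<open>?r\<close> has at least n + 1.\<close>
  moreover have "length p = length q" using p q by (auto simp: longest_path_def intro: antisym)
  ultimately show False using p' q' by simp
qed

lemma lpt_le_card: "lp_transversal G T \<Longrightarrow> lpt G \<le> card T"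
  unfolding lpt_def by (rule Least_le) blast

section \<open>Connected sets in a subdivision\<close>

lemma interior_nth: "interior p = {p ! k | k. 0 < k \<and> Suc k < length p}"
proof
  show "interior p \<subseteq> {p ! k | k. 0 < k \<and> Suc k < length p}"
  proof
    fix z assume "z \<in> interior p"
    then obtain k where "k < length (butlast (tl p))" "z = butlast (tl p) ! k"
      unfolding interior_def by (metis in_set_conv_nth)
    thus "z \<in> {p ! k | k. 0 < k \<and> Suc k < length p}"
      by (auto simp: nth_butlast nth_tl intro!: exI[of _ "Suc k"])
  qed
  show "{p ! k | k. 0 < k \<and> Suc k < length p} \<subseteq> interior p"
  proof
    fix z assume "z \<in> {p ! k | k. 0 < k \<and> Suc k < length p}"
    then obtain k where k: "0 < k" "Suc k < length p" "z = p ! k" by blast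
    hence "butlast (tl p) ! (k - 1) = z" "k - 1 < length (butlast (tl p))"
      by (auto simp: nth_butlast nth_tl)
    thus "z \<in> interior p" unfolding interior_def by (metis nth_mem)
  qed
qed

lemma interior_rev: "interior (rev p) = interior p"
proof -
  have "tl (rev p) = rev (butlast p)" by (metis butlast_rev rev_rev_ident)
  thus ?thesis by (simp add: interior_def butlast_rev butlast_tl)
qed

lemma conn_Un:
  assumes "conn G X" "conn G Y" "X \<inter> Y \<noteq> {}"
  shows "conn G (X \<union> Y)"
proof (rule connI)
  fix Z assume Z: "Z \<subseteq> X \<union> Y" "Z \<noteq> {}"
    and cl: "\<And>y x. y \<in> Z \<Longrightarrow> x \<in> X \<union> Y \<Longrightarrow> adj G y x \<Longrightarrow> x \<in> Z"
  have *: "Z \<inter> W = W" if "conn G W" "W \<subseteq> X \<union> Y" "Z \<inter> W \<noteq> {}" for W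
    by (rule connD[OF that(1)]) (use that cl in auto)
  show "X \<union> Y \<subseteq> Z" using *[of X] *[of Y] assms Z by blast
qed

lemma conn_UN_path:
  assumes "successively (\<lambda>u v. f u \<inter> f v \<noteq> {}) p" "p \<noteq> []" "\<And>v. v \<in> set p \<Longrightarrow> conn G (f v)"
  shows "conn G (\<Union>v\<in>set p. f v)"
  using assms
proof (induction p)
  case (Cons a p)
  show ?case
  proof (cases p)
    case Nil
    then show ?thesis using Cons.prems by simp
  next
    case (Cons b q)
    have "conn G (\<Union>v\<in>set p. f v)" using Cons.IH Cons.prems Cons by simp
    moreover have "f a \<inter> (\<Union>v\<in>set p. f v) \<noteq> {}" using Cons.prems Cons by auto
    ultimately show ?thesis using conn_Un[of G "f a" "\<Union>v\<in>set p. f v"] Cons.prems by simp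
  qed
qed simp

text \<open>The witnesses of \<open>subdivision_of\<close> are fixed, so that each subdivided edge
  has a concrete path \<open>P e\<close>.\<close>

locale subdivided =
  fixes S :: "nat graph" and H :: "'h graph" and \<iota> :: "'h \<Rightarrow> nat" and P :: "'h set \<Rightarrow> nat list"
  assumes simple_H: "simple_graph H" and connected_H: "connected H" and card_H: "card (verts H) \<ge> 2"
    and inj: "inj_on \<iota> (verts H)"
    and P_path: "\<And>e. e \<in> edges H \<Longrightarrow> is_path S (P e)"
    and P_len: "\<And>e. e \<in> edges H \<Longrightarrow> length (P e) \<ge> 2"
    and P_ends: "\<And>e. e \<in> edges H \<Longrightarrow> {hd (P e), last (P e)} = \<iota> ` e"
    and P_inner: "\<And>e. e \<in> edges H \<Longrightarrow> interior (P e) \<inter> \<iota> ` verts H = {}"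
    and P_disj: "\<And>e f. e \<in> edges H \<Longrightarrow> f \<in> edges H \<Longrightarrow> e \<noteq> f \<Longrightarrow> interior (P e) \<inter> interior (P f) = {}"
    and verts_S: "verts S = \<iota> ` verts H \<union> (\<Union>e\<in>edges H. set (P e))"
    and edges_S: "edges S = (\<Union>e\<in>edges H. path_edges (P e))"
begin

lemma edge_subset: "e \<in> edges H \<Longrightarrow> e \<subseteq> verts H"
  using simple_H by (auto simp: simple_graph_def)

lemma finite_edges: "finite (edges H)"
  using edge_subset simple_H by (auto intro: finite_subset[of _ "Pow (verts H)"] simp: simple_graph_def)

text \<open>Listing each subdivided edge in both directions lets every branch vertex be the start of
  a ray; this is the origin of 2 |E(H)|.\<close>

definition rays :: "nat list set" where
  "rays = P ` edges H \<union> rev ` P ` edges H"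

lemma finite_rays: "finite rays"
  using finite_edges by (simp add: rays_def)

lemma card_rays: "card rays \<le> 2 * card (edges H)"
proof -
  have "card rays \<le> card (P ` edges H) + card (rev ` P ` edges H)"
    unfolding rays_def by (rule card_Un_le)
  moreover have "card (P ` edges H) \<le> card (edges H)" using finite_edges by (rule card_image_le)
  moreover have "card (rev ` P ` edges H) \<le> card (P ` edges H)"
    using finite_edges by (intro card_image_le) simp
  ultimately show ?thesis by linarith
qed

lemma P_rays: "e \<in> edges H \<Longrightarrow> P e \<in> rays" "e \<in> edges H \<Longrightarrow> rev (P e) \<in> rays"
  by (auto simp: rays_def)

lemma rayE:
  assumes "p \<in> rays"
  obtains e where "e \<in> edges H" "p = P e \<or> p = rev (P e)" "distinct p" "length p \<ge> 2"
    "{p ! 0, p ! (length p - 1)} = \<iota> ` e" "interior p = interior (P e)"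
proof -
  obtain e where e: "e \<in> edges H" "p = P e \<or> p = rev (P e)" using assms by (auto simp: rays_def)
  have ne: "P e \<noteq> []" using P_len[OF e(1)] by auto
  have "distinct p" "length p \<ge> 2" using e P_path[OF e(1)] P_len[OF e(1)] by (auto simp: is_path_iff)
  moreover from this have "{p ! 0, p ! (length p - 1)} = {hd p, last p}"
    by (cases "p = []") (auto simp: hd_conv_nth last_conv_nth)
  hence "{p ! 0, p ! (length p - 1)} = \<iota> ` e"
    using e(2) ne P_ends[OF e(1)] by (auto simp: hd_rev last_rev insert_commute)
  moreover have "interior p = interior (P e)"
    using e(2) by (auto simp: interior_rev)
  ultimately show ?thesis using that e by blast
qed

lemma ray_start:
  assumes "p \<in> rays"
  shows "p ! 0 \<in> \<iota> ` verts H"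
proof -
  obtain e where "e \<in> edges H" "{p ! 0, p ! (length p - 1)} = \<iota> ` e"
    using assms by (rule rayE)
  thus ?thesis using edge_subset[of e] by blast
qed

lemma ray_inner_not_branch:
  assumes "p \<in> rays" "0 < k" "Suc k < length p"
  shows "p ! k \<notin> \<iota> ` verts H"
proof -
  obtain e where e: "e \<in> edges H" "interior p = interior (P e)"
    using assms(1) by (rule rayE)
  have "p ! k \<in> interior p" using assms by (auto simp: interior_nth)
  thus ?thesis using P_inner[OF e(1)] e(2) by blast
qed

text \<open>The vertex is no branch vertex, so it is interior to \<open>p\<close> too. Interiors of
  different subdivided edges are disjoint, which leaves only the direction open.\<close>

lemma ray_inner_unique:
  assumes p: "p \<in> rays" and q: "q \<in> rays" and j: "0 < j" "Suc j < length q"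
    and i: "i < length p" and eq: "p ! i = q ! j"
  shows "p = q \<and> i = j \<or> p = rev q \<and> i = length q - 1 - j"
proof -
  obtain e where e: "e \<in> edges H" "p = P e \<or> p = rev (P e)" "distinct p"
    "{p ! 0, p ! (length p - 1)} = \<iota> ` e" "interior p = interior (P e)"
    using p by (rule rayE)
  obtain f where f: "f \<in> edges H" "q = P f \<or> q = rev (P f)" "distinct q"
    "interior q = interior (P f)"
    using q by (rule rayE)
  have "p ! i \<notin> \<iota> ` verts H" using ray_inner_not_branch[OF q j] eq by simp
  hence "p ! i \<notin> {p ! 0, p ! (length p - 1)}" using e(4) edge_subset[OF e(1)] by blast
  hence i0: "0 < i" "Suc i < length p" using i by (cases "i = 0"; cases "i = length p - 1"; auto)+
  have "p ! i \<in> interior p" "q ! j \<in> interior q" using i0 j by (auto simp: interior_nth)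
  hence "e = f" using P_disj e f eq by (metis disjoint_iff)
  hence "p = q \<or> p = rev q" using e(2) f(2) by auto
  thus ?thesis
  proof
    assume "p = q"
    thus ?thesis using eq i j f(3) by (simp add: nth_eq_iff_index_eq)
  next
    assume pq: "p = rev q"
    hence "q ! (length q - Suc i) = q ! j" using eq i by (simp add: rev_nth)
    hence "length q - Suc i = j" using i j f(3) pq by (simp add: nth_eq_iff_index_eq)
    thus ?thesis using pq i by auto
  qed
qed

lemma adj_on_ray:
  assumes "adj S z x"
  obtains q j where "q \<in> rays" "Suc j < length q" "z = q ! j" "x = q ! Suc j"
proof -
  obtain f k where f: "f \<in> edges H" "{z, x} = {P f ! k, P f ! Suc k}" "Suc k < length (P f)"
    using assms by (auto simp: edges_S path_edges_def)
  from f(2) consider "z = P f ! k" "x = P f ! Suc k" | "x = P f ! k" "z = P f ! Suc k"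
    by (auto simp: doubleton_eq_iff)
  thus ?thesis
  proof cases
    case 1
    thus ?thesis using that P_rays f by blast
  next
    case 2
    \<comment> \<open>Reversal sends positions k + 1 and k to \<open>?j\<close> and
      \<open>Suc ?j\<close>.\<close>
    let ?j = "length (P f) - 2 - k"
    have "z = rev (P f) ! ?j" "x = rev (P f) ! Suc ?j"
      using 2 f(3) by (auto simp: rev_nth Suc_diff_Suc)
    thus ?thesis using that[of "rev (P f)" ?j] P_rays f by auto
  qed
qed

lemma inner_adj:
  assumes e: "e \<in> edges H" and k: "0 < k" "Suc k < length (P e)" and a: "adj S (P e ! k) x"
  shows "x = P e ! (k - 1) \<or> x = P e ! Suc k"
proof -
  obtain q j where q: "q \<in> rays" "Suc j < length q" "P e ! k = q ! j" "x = q ! Suc j"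
    using a by (rule adj_on_ray)
  have "q = P e \<and> j = k \<or> q = rev (P e) \<and> j = length (P e) - 1 - k"
    by (rule ray_inner_unique) (use e k q P_rays in auto)
  thus ?thesis using q k by (auto simp: rev_nth Suc_diff_Suc)
qed

text \<open>If \<open>X\<close> misses a position on either side of \<open>i\<close>, let
  \<open>k1\<close> and \<open>k2\<close> be the nearest ones. The stretch strictly between is
  closed in \<open>X\<close>, as inner vertices are adjacent only to their neighbours on the path;
  hence it is all of \<open>X\<close>.\<close>

lemma segment_cases:
  assumes X: "conn S X" and e: "e \<in> edges H" and i: "i < length (P e)" "P e ! i \<in> X"
  obtains (left) "(!) (P e) ` {..i} \<subseteq> X"
    | (right) "(!) (P e) ` {i..<length (P e)} \<subseteq> X"
    | (inner) k1 k2 where "k2 < length (P e)" "X = (!) (P e) ` {k1<..<k2}"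
proof -
  let ?p = "P e"
  show ?thesis
  proof (cases "(!) ?p ` {..i} \<subseteq> X \<or> (!) ?p ` {i..<length ?p} \<subseteq> X")
    case True
    then show ?thesis using that by blast
  next
    case False
    define L where "L = {k. k \<le> i \<and> ?p ! k \<notin> X}"
    define R where "R = {k. i \<le> k \<and> k < length ?p \<and> ?p ! k \<notin> X}"
    have fin: "finite L" "L \<noteq> {}" "finite R" "R \<noteq> {}" using False by (auto simp: L_def R_def)
    define k1 where "k1 = Max L"
    define k2 where "k2 = Min R"
    have "k1 \<in> L" "k2 \<in> R" using fin by (auto simp: k1_def k2_def)
    hence k1: "k1 \<le> i" "?p ! k1 \<notin> X" and k2: "i \<le> k2" "k2 < length ?p" "?p ! k2 \<notin> X"
      by (auto simp: L_def R_def)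
    have in1: "?p ! k \<in> X" if "k1 < k" "k \<le> i" for k
      using that fin Max_ge[of L k] by (force simp: k1_def L_def)
    have in2: "?p ! k \<in> X" if "i \<le> k" "k < k2" for k
    proof (rule ccontr)
      assume "?p ! k \<notin> X"
      hence "k \<in> R" using that k2(2) by (simp add: R_def)
      thus False using Min_le[OF fin(3), of k] that(2) by (simp add: k2_def)
    qed
    have ne: "k1 \<noteq> i" "k2 \<noteq> i" using i k1 k2 by auto
    have "(!) ?p ` {k1<..<k2} = X"
    proof (rule connD[OF X])
      show "(!) ?p ` {k1<..<k2} \<subseteq> X" using in1 in2 linear by fastforce
      have "i \<in> {k1<..<k2}" using ne k1(1) k2(1) by simp
      thus "(!) ?p ` {k1<..<k2} \<noteq> {}" by blast
      fix y x assume y: "y \<in> (!) ?p ` {k1<..<k2}" and x: "x \<in> X" and a: "adj S y x"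
      obtain k where k: "y = ?p ! k" "k1 < k" "k < k2" using y by auto
      have "x = ?p ! (k - 1) \<or> x = ?p ! Suc k"
        using inner_adj[OF e, of k x] k k2 a by auto
      thus "x \<in> (!) ?p ` {k1<..<k2}"
      proof
        assume "x = ?p ! (k - 1)"
        moreover from this have "k - 1 \<noteq> k1" using k1 x by auto
        hence "k - 1 \<in> {k1<..<k2}" using k by auto
        ultimately show ?thesis by blast
      next
        assume "x = ?p ! Suc k"
        moreover from this have "Suc k \<noteq> k2" using k2 x by auto
        hence "Suc k \<in> {k1<..<k2}" using k by auto
        ultimately show ?thesis by blast
      qed
    qed
    thus ?thesis using that k2 by blast
  qed
qed

section \<open>Branch vertices of connected sets\<close>

definition branch :: "nat set \<Rightarrow> 'h set" where
  "branch X = {h \<in> verts H. \<iota> h \<in> X}"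

lemma inner_segment_no_branch:
  assumes e: "e \<in> edges H" and k: "k2 < length (P e)" and X: "X = (!) (P e) ` {k1<..<k2}"
  shows "branch X = {}"
proof -
  have "P e ! k \<notin> \<iota> ` verts H" if "k1 < k" "k < k2" for k
    using ray_inner_not_branch[OF P_rays(1)[OF e], of k] that k by simp
  thus ?thesis using X by (auto simp: branch_def image_iff) metis
qed

lemma P_first_last:
  assumes "e \<in> edges H"
  obtains h h' where "h \<in> e" "P e ! 0 = \<iota> h" "h' \<in> e" "P e ! (length (P e) - 1) = \<iota> h'"
proof -
  have "P e \<noteq> []" using P_len[OF assms] by auto
  hence "{P e ! 0, P e ! (length (P e) - 1)} = \<iota> ` e"
    using P_ends[OF assms] by (simp add: hd_conv_nth last_conv_nth)
  hence "P e ! 0 \<in> \<iota> ` e" "P e ! (length (P e) - 1) \<in> \<iota> ` e" by auto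
  thus ?thesis using that by blast
qed

text \<open>A set containing neither end would be an inner segment, which has no branch
  vertices.\<close>

lemma contains_end:
  assumes X: "conn S X" "branch X \<noteq> {}" and e: "e \<in> edges H" and i: "i < length (P e)" "P e ! i \<in> X"
  shows "\<exists>h\<in>e. \<iota> h \<in> X"
proof -
  obtain h h' where h: "h \<in> e" "P e ! 0 = \<iota> h" "h' \<in> e" "P e ! (length (P e) - 1) = \<iota> h'"
    using P_first_last[OF e] .
  show ?thesis using X(1) e i
  proof (cases rule: segment_cases)
    case left
    hence "P e ! 0 \<in> X" by auto
    thus ?thesis using h by auto
  next
    case right
    moreover have "length (P e) - 1 \<in> {i..<length (P e)}" using i by auto
    ultimately have "P e ! (length (P e) - 1) \<in> X" by blast
    thus ?thesis using h by auto
  next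
    case inner
    thus ?thesis using inner_segment_no_branch[OF e] X(2) by blast
  qed
qed

text \<open>For an isolated \<open>h\<close> the set {h} would be closed, so connectedness would
  leave \<open>H\<close> a single vertex.\<close>

lemma vertex_in_edge:
  assumes "h \<in> verts H"
  shows "\<exists>e\<in>edges H. h \<in> e"
proof (rule ccontr)
  assume "\<not> (\<exists>e\<in>edges H. h \<in> e)"
  hence "{h} = verts H"
    using assms by (intro connD[OF conn_verts[OF simple_H connected_H]]) auto
  hence "card (verts H) = 1" by (metis is_singletonI is_singleton_altdef)
  thus False using card_H by simp
qed

lemma branch_ray:
  assumes "h \<in> verts H"
  shows "\<exists>p\<in>rays. p ! 0 = \<iota> h"
proof -
  obtain e where e: "e \<in> edges H" "h \<in> e" using vertex_in_edge assms by blast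
  have ne: "P e \<noteq> []" using P_len[OF e(1)] by auto
  have "\<iota> h = hd (P e) \<or> \<iota> h = last (P e)" using P_ends[OF e(1)] e(2) by auto
  thus ?thesis using P_rays[OF e(1)] ne by (metis hd_conv_nth hd_rev rev_is_Nil_conv)
qed

lemma vertex_on_P:
  assumes "z \<in> verts S"
  obtains e i where "e \<in> edges H" "i < length (P e)" "z = P e ! i"
proof -
  have "\<exists>e\<in>edges H. z \<in> set (P e)"
  proof (cases "z \<in> \<iota> ` verts H")
    case True
    then obtain h e where e: "e \<in> edges H" "h \<in> e" "z = \<iota> h" using vertex_in_edge by blast
    hence "z \<in> {hd (P e), last (P e)}" using P_ends by auto
    moreover have "P e \<noteq> []" using P_len[OF e(1)] by auto
    ultimately have "z \<in> set (P e)" by auto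
    thus ?thesis using e by blast
  qed (use assms verts_S in auto)
  thus ?thesis using that by (metis in_set_conv_nth)
qed

text \<open>This makes the farthest selection applicable. A final segment of \<open>P e\<close>
  becomes an initial one of the reversed ray.\<close>

lemma reached_along_ray:
  assumes X: "conn S X" "branch X \<noteq> {}" and z: "z \<in> X" "z \<in> verts S"
  shows "\<exists>p\<in>rays. \<exists>i. z = p ! i \<and> (!) p ` {..i} \<subseteq> X"
proof -
  obtain e i where e: "e \<in> edges H" "i < length (P e)" "z = P e ! i"
    using z by (auto elim: vertex_on_P)
  have "P e ! i \<in> X" using z e by simp
  with X(1) e(1,2) show ?thesis
  proof (cases rule: segment_cases)
    case left
    thus ?thesis using e P_rays by blast
  next
    case right
    let ?i = "length (P e) - 1 - i"
    have "rev (P e) ! k \<in> X" if "k \<le> ?i" for k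
    proof -
      have "length (P e) - Suc k \<in> {i..<length (P e)}" "k < length (P e)" using that e(2) by auto
      thus ?thesis using right by (auto simp: rev_nth image_subset_iff simp del: atLeastLessThan_iff)
    qed
    moreover have "z = rev (P e) ! ?i" using e by (auto simp: rev_nth)
    ultimately show ?thesis using P_rays(2)[OF e(1)] by blast
  next
    case inner
    thus ?thesis using inner_segment_no_branch[OF e(1)] X(2) by blast
  qed
qed

text \<open>For a closed \<open>Y\<close>, let \<open>Z\<close> collect the points reached from
  \<open>Y\<close> along rays inside \<open>X\<close>. It is closed, hence all of \<open>X\<close>.
  Its branch vertices belong to \<open>Y\<close>, since a ray inside \<open>X\<close> from one
  branch vertex to another comes from an edge of \<open>H\<close>.\<close>

lemma branch_conn:
  assumes X: "conn S X"
  shows "conn H (branch X)"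
proof (rule connI)
  fix Y assume Y: "Y \<subseteq> branch X" "Y \<noteq> {}"
    and cl: "\<And>y x. y \<in> Y \<Longrightarrow> x \<in> branch X \<Longrightarrow> adj H y x \<Longrightarrow> x \<in> Y"
  define Z where "Z = {p ! i | p i. p \<in> rays \<and> i < length p \<and> (!) p ` {..i} \<subseteq> X \<and> p ! 0 \<in> \<iota> ` Y}"
  have ZI: "z \<in> Z" if "p \<in> rays" "i < length p" "(!) p ` {..i} \<subseteq> X" "p ! 0 \<in> \<iota> ` Y" "z = p ! i" for z p i
    using that unfolding Z_def by blast
  have ray_ne: "p \<noteq> []" if "p \<in> rays" for p
    using that by (rule rayE) auto
  have Z_branch: "z \<in> \<iota> ` Y" if z: "z \<in> Z" "z \<in> \<iota> ` verts H" for z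
  proof -
    obtain p i where p: "p \<in> rays" "i < length p" "(!) p ` {..i} \<subseteq> X" "p ! 0 \<in> \<iota> ` Y" "z = p ! i"
      using z(1) unfolding Z_def by blast
    obtain e where e: "e \<in> edges H" "distinct p" "length p \<ge> 2"
      "{p ! 0, p ! (length p - 1)} = \<iota> ` e"
      using p(1) by (rule rayE)
    show ?thesis
    proof (cases "i = 0")
      case False
      \<comment> \<open>Past position 0 only the far end is a branch vertex, so the whole ray lies
        in \<open>X\<close>.\<close>
      hence i: "i = length p - 1" using ray_inner_not_branch[OF p(1), of i] z(2) p by (cases "Suc i < length p") auto
      obtain h0 where h0: "h0 \<in> Y" "p ! 0 = \<iota> h0" using p by blast
      obtain h where h: "h \<in> e" "z = \<iota> h" using e(4) i p(5) by blast
      have hv: "h \<in> verts H" using h edge_subset e by blast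
      have "\<iota> h0 \<in> \<iota> ` e" using h0 e(4) by auto
      moreover have h0v: "h0 \<in> verts H" using h0 Y by (auto simp: branch_def)
      ultimately have "h0 \<in> e" using inj edge_subset[OF e(1)] by (metis inj_on_image_mem_iff)
      have "p ! 0 \<noteq> p ! i" using e p False by (metis length_pos_if_in_set nth_eq_iff_index_eq nth_mem)
      hence "h0 \<noteq> h" using h0 h p by auto
      hence "e = {h0, h}" using \<open>h0 \<in> e\<close> h e(1) simple_H by (auto simp: simple_graph_def)
      moreover have "h \<in> branch X" using hv h p by (auto simp: branch_def)
      ultimately have "h \<in> Y" using cl h0 e by blast
      thus ?thesis using h by blast
    qed (use p in auto)
  qed
  have "Z = X"
  proof (rule connD[OF X])
    show "Z \<subseteq> X" by (auto simp: Z_def)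
    obtain h where h: "h \<in> Y" using Y by blast
    hence hX: "h \<in> verts H" "\<iota> h \<in> X" using Y by (auto simp: branch_def)
    then obtain p where p: "p \<in> rays" "p ! 0 = \<iota> h" using branch_ray by blast
    have "\<iota> h \<in> Z" by (rule ZI[of p 0]) (use p h hX ray_ne in auto)
    thus "Z \<noteq> {}" by blast
    fix z x assume z: "z \<in> Z" and x: "x \<in> X" and a: "adj S z x"
    obtain q j where q: "q \<in> rays" "Suc j < length q" "z = q ! j" "x = q ! Suc j"
      using a by (rule adj_on_ray)
    \<comment> \<open>At a branch vertex a new ray starts, in \<open>Y\<close> by
      \<open>Z_branch\<close>. At an inner vertex the ray is determined up to direction, and
      \<open>x\<close> is one step forward or back on it.\<close>
    show "x \<in> Z"
    proof (cases "j = 0")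
      case True
      hence "z \<in> \<iota> ` Y" using Z_branch[OF z] ray_start q by simp
      moreover have "z \<in> X" using \<open>Z \<subseteq> X\<close> z by blast
      ultimately show ?thesis using True q x by (intro ZI[of q 1]) (auto simp: atMost_Suc)
    next
      case False
      obtain p i where p: "p \<in> rays" "i < length p" "(!) p ` {..i} \<subseteq> X" "p ! 0 \<in> \<iota> ` Y" "z = p ! i"
        using z unfolding Z_def by blast
      have "p = q \<and> i = j \<or> p = rev q \<and> i = length q - 1 - j"
        by (rule ray_inner_unique) (use p q False in auto)
      thus ?thesis
      proof
        assume "p = q \<and> i = j"
        thus ?thesis using p q x by (intro ZI[of p "Suc i"]) (auto simp: atMost_Suc)
      next
        assume pq: "p = rev q \<and> i = length q - 1 - j"
        hence "x = p ! (i - 1)" using q by (auto simp: rev_nth Suc_diff_Suc)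
        thus ?thesis using p by (intro ZI[of p "i - 1"]) auto
      qed
    qed
  qed
  show "branch X \<subseteq> Y"
  proof
    fix h assume h: "h \<in> branch X"
    hence "\<iota> h \<in> \<iota> ` Y" using Z_branch[of "\<iota> h"] \<open>Z = X\<close> by (auto simp: branch_def)
    moreover have "Y \<subseteq> verts H" "h \<in> verts H" using Y h by (auto simp: branch_def)
    ultimately show "h \<in> Y" using inj by (metis inj_on_image_mem_iff)
  qed
qed

text \<open>Both sets contain an end of the subdivided edge through \<open>z\<close>, and its ends
  are adjacent in \<open>H\<close>.\<close>

lemma branch_touch:
  assumes X: "conn S X" "branch X \<noteq> {}" and Y: "conn S Y" "branch Y \<noteq> {}"
    and z: "z \<in> X" "z \<in> Y" "z \<in> verts S"
  shows "\<exists>x\<in>branch X. \<exists>y\<in>branch Y. x = y \<or> adj H x y"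
proof -
  obtain e i where e: "e \<in> edges H" "i < length (P e)" "z = P e ! i"
    using z by (auto elim: vertex_on_P)
  obtain x y where xy: "x \<in> e" "\<iota> x \<in> X" "y \<in> e" "\<iota> y \<in> Y"
    using contains_end[OF X e(1,2)] contains_end[OF Y e(1,2)] z e by auto
  have "x \<in> branch X" "y \<in> branch Y" using xy edge_subset[OF e(1)] by (auto simp: branch_def)
  moreover have "x = y \<or> e = {x, y}" using xy e(1) simple_H by (auto simp: simple_graph_def)
  ultimately show ?thesis using e by blast
qed

end

section \<open>Small transversals of the longest paths through a clique\<close>

text \<open>Initial segments of a ray are nested, so finitely many sets can be compared by how far
  they reach.\<close>

lemma farthest_on_ray:
  assumes "finite A" "A \<noteq> {}"
  shows "\<exists>x\<in>A. \<forall>v\<in>A. \<forall>i::nat. \<rho> ` {..i} \<subseteq> f v \<longrightarrow> \<rho> ` {..i} \<subseteq> f x"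
  using assms
proof (induction A rule: finite_ne_induct)
  case (insert a A)
  then obtain x where x: "x \<in> A" "\<forall>v\<in>A. \<forall>i. \<rho> ` {..i} \<subseteq> f v \<longrightarrow> \<rho> ` {..i} \<subseteq> f x" by blast
  show ?case
  proof (cases "\<forall>i. \<rho> ` {..i} \<subseteq> f a \<longrightarrow> \<rho> ` {..i} \<subseteq> f x")
    case True
    then show ?thesis using x by blast
  next
    case False
    then obtain i where i: "\<rho> ` {..i} \<subseteq> f a" "\<not> \<rho> ` {..i} \<subseteq> f x" by blast
    have "\<rho> ` {..j} \<subseteq> f a" if "\<rho> ` {..j} \<subseteq> f x" for j
    proof -
      have "\<rho> ` {..i} \<subseteq> \<rho> ` {..j}" if "i \<le> j" using that by auto
      hence "j \<le> i" using i(2) that by (meson nle_le order_trans)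
      hence "\<rho> ` {..j} \<subseteq> \<rho> ` {..i}" by auto
      thus ?thesis using i(1) by blast
    qed
    then show ?thesis using x by blast
  qed
qed auto

lemma farthest_selection:
  assumes A: "finite A" and D: "finite D"
  obtains T where "T \<subseteq> A" "card T \<le> card D"
    "\<And>v \<rho> i. v \<in> A \<Longrightarrow> \<rho> \<in> D \<Longrightarrow> \<rho> ` {..i::nat} \<subseteq> f v \<Longrightarrow> \<exists>x\<in>T. \<rho> ` {..i} \<subseteq> f x"
proof (cases "A = {}")
  case True
  then show ?thesis using that[of "{}"] by simp
next
  case False
  obtain c where c: "\<And>\<rho>. c \<rho> \<in> A \<and> (\<forall>v\<in>A. \<forall>i::nat. \<rho> ` {..i} \<subseteq> f v \<longrightarrow> \<rho> ` {..i} \<subseteq> f (c \<rho>))"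
    using farthest_on_ray[OF A False, of _ f] by metis
  show ?thesis
  proof (rule that[of "c ` D"])
    show "card (c ` D) \<le> card D" using D by (rule card_image_le)
  qed (use c in blast)+
qed

locale represented = subdivided S H \<iota> P
  for S :: "nat graph" and H :: "'h graph" and \<iota> P +
  fixes G :: "'a graph" and \<Phi> :: "'a \<Rightarrow> nat set"
  assumes simple_G: "simple_graph G" and connected_G: "connected G"
    and \<Phi>_sub: "\<And>v. v \<in> verts G \<Longrightarrow> \<Phi> v \<subseteq> verts S"
    and \<Phi>_conn: "\<And>v. v \<in> verts G \<Longrightarrow> connected (induced S (\<Phi> v))"
    and adj_G: "\<And>u v. u \<in> verts G \<Longrightarrow> v \<in> verts G \<Longrightarrow> u \<noteq> v \<Longrightarrow> adj G u v \<longleftrightarrow> \<Phi> u \<inter> \<Phi> v \<noteq> {}"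
begin

lemma adj_meet:
  assumes "adj G u v"
  shows "\<Phi> u \<inter> \<Phi> v \<noteq> {}"
proof -
  obtain x y where "x \<noteq> y" "x \<in> verts G" "y \<in> verts G" "{u, v} = {x, y}"
    using simple_G assms unfolding simple_graph_def by blast
  hence "u \<noteq> v" "u \<in> verts G" "v \<in> verts G" by (auto simp: doubleton_eq_iff)
  thus ?thesis using adj_G assms by blast
qed

text \<open>If \<open>T\<close> missed \<open>p\<close>, a longer path would arise by inserting, right after \<open>v\<close>, an element of
  \<open>T\<close> that represents a point shared by \<open>v\<close> and its successor.\<close>

lemma longest_path_hits:
  assumes p: "longest_path G p" and v: "v \<in> set p" "s \<in> \<Phi> v"
    and T: "T \<subseteq> {x \<in> verts G. s \<in> \<Phi> x}" "\<And>t. t \<in> \<Phi> v \<Longrightarrow> \<exists>x\<in>T. t \<in> \<Phi> x"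
  shows "T \<inter> set p \<noteq> {}"
proof
  assume dis: "T \<inter> set p = {}"
  have pp: "is_path G p" using p by (simp add: longest_path_def)
  have longest: "length q \<le> length p" if "is_path G q" for q
    using p that by (simp add: longest_path_def)
  obtain a b where ab: "p = a @ v # b" using v by (meson split_list)
  have vG: "v \<in> verts G" using pp v by (auto simp: is_path_iff)
  have new: "x \<in> verts G" "x \<notin> set p" "adj G v x" if "x \<in> T" for x
  proof -
    show "x \<in> verts G" "x \<notin> set p" using that T dis by auto
    thus "adj G v x" using adj_G[OF vG, of x] that T v by blast
  qed
  show False
  proof (cases b)
    case Nil
    \<comment> \<open>When \<open>v\<close> ends the path there is no successor, and an element of
      \<open>T\<close> is appended instead.\<close>
    obtain x where x: "x \<in> T" using T(2)[OF v(2)] by blast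
    have "is_path G (p @ [x])"
      using pp new[OF x] ab Nil by (auto simp: is_path_iff successively_append_iff)
    thus False using longest by fastforce
  next
    case (Cons w c)
    have "adj G v w" using pp ab Cons by (auto simp: is_path_iff successively_append_iff)
    then obtain t where t: "t \<in> \<Phi> v" "t \<in> \<Phi> w" using adj_meet by blast
    then obtain x where x: "x \<in> T" "t \<in> \<Phi> x" using T(2) by blast
    have "w \<in> verts G" "x \<noteq> w" using pp ab Cons new[OF x(1)] by (auto simp: is_path_iff)
    hence "adj G x w" using adj_G[of x w] new[OF x(1)] x t by blast
    hence "is_path G (a @ v # x # b)"
      using pp new[OF x(1)] ab Cons by (auto simp: is_path_iff successively_append_iff successively_Cons)
    thus False using longest ab by fastforce
  qed
qed

definition trace :: "'a list \<Rightarrow> nat set" where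
  "trace p = (\<Union>v\<in>set p. \<Phi> v)"

lemma \<Phi>_conn': "v \<in> verts G \<Longrightarrow> conn S (\<Phi> v)" "v \<in> verts G \<Longrightarrow> \<Phi> v \<noteq> {}"
  using \<Phi>_conn by (simp_all add: connected_induced_iff)

lemma longest_verts: "longest_path G p \<Longrightarrow> set p \<subseteq> verts G" "longest_path G p \<Longrightarrow> p \<noteq> []"
  by (auto simp: longest_path_def is_path_iff)

lemma trace_conn:
  assumes "longest_path G p"
  shows "conn S (trace p)"
  unfolding trace_def
proof (rule conn_UN_path)
  have "successively (adj G) p" using assms by (simp add: longest_path_def is_path_iff)
  thus "successively (\<lambda>u v. \<Phi> u \<inter> \<Phi> v \<noteq> {}) p"
    by (rule successively_mono) (use adj_meet in blast)
qed (use longest_verts[OF assms] \<Phi>_conn' in blast)+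

lemma trace_sub: "longest_path G p \<Longrightarrow> trace p \<subseteq> verts S"
  using longest_verts(1) \<Phi>_sub unfolding trace_def by blast

lemma trace_meet:
  assumes "longest_path G p" "longest_path G q"
  obtains z where "z \<in> trace p" "z \<in> trace q" "z \<in> verts S"
proof -
  obtain v where v: "v \<in> set p" "v \<in> set q"
    using longest_paths_meet[OF connected_G assms] by blast
  have vG: "v \<in> verts G" using longest_verts(1)[OF assms(1)] v by blast
  then obtain z where "z \<in> \<Phi> v" using \<Phi>_conn'(2) by blast
  thus ?thesis using that v \<Phi>_sub[OF vG] by (auto simp: trace_def)
qed

text \<open>The selection runs over all rays, not only those starting at \<open>\<iota> h\<close>,
  because \<open>\<Phi> v\<close> may extend beyond further branch vertices.\<close>

lemma branch_selection:
  assumes h: "h \<in> verts H"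
  shows "\<exists>T\<subseteq>verts G. card T \<le> 2 * card (edges H) \<and>
    (\<forall>p. longest_path G p \<longrightarrow> \<iota> h \<in> trace p \<longrightarrow> T \<inter> set p \<noteq> {})"
proof -
  define A where "A = {v \<in> verts G. \<iota> h \<in> \<Phi> v}"
  have fA: "finite A" using simple_G by (simp add: A_def simple_graph_def)
  obtain T where T: "T \<subseteq> A" "card T \<le> card ((!) ` rays)"
    "\<And>v \<rho> i. v \<in> A \<Longrightarrow> \<rho> \<in> (!) ` rays \<Longrightarrow> \<rho> ` {..i::nat} \<subseteq> \<Phi> v \<Longrightarrow> \<exists>x\<in>T. \<rho> ` {..i} \<subseteq> \<Phi> x"
    using farthest_selection[OF fA, of "(!) ` rays" \<Phi>] finite_rays by blast
  have "card T \<le> 2 * card (edges H)"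
    using T(2) card_image_le[OF finite_rays, of "(!)"] card_rays by linarith
  moreover have "T \<inter> set p \<noteq> {}" if p: "longest_path G p" "\<iota> h \<in> trace p" for p
  proof -
    obtain v where v: "v \<in> set p" "\<iota> h \<in> \<Phi> v" using p by (auto simp: trace_def)
    have vG: "v \<in> verts G" using v longest_verts p by blast
    have "\<exists>x\<in>T. t \<in> \<Phi> x" if t: "t \<in> \<Phi> v" for t
    proof -
      have "branch (\<Phi> v) \<noteq> {}" using v h by (auto simp: branch_def)
      then obtain q i where q: "q \<in> rays" "t = q ! i" "(!) q ` {..i} \<subseteq> \<Phi> v"
        using reached_along_ray[OF \<Phi>_conn'(1)[OF vG]] t \<Phi>_sub[OF vG] by blast
      then obtain x where "x \<in> T" "(!) q ` {..i} \<subseteq> \<Phi> x" using T(3)[of v "(!) q" i] v vG by (auto simp: A_def)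
      thus ?thesis using q(2) by blast
    qed
    thus ?thesis using longest_path_hits[OF p(1) v] T(1) by (simp add: A_def)
  qed
  ultimately show ?thesis using T(1) by (auto simp: A_def)
qed

text \<open>Without branch vertices, \<open>\<Phi> v\<close> is an interval around position
  \<open>j\<close>, so two directions suffice.\<close>

lemma inner_selection:
  assumes e: "e \<in> edges H" and j: "j < length (P e)"
  shows "\<exists>T\<subseteq>verts G. card T \<le> 2 \<and>
    (\<forall>p. longest_path G p \<longrightarrow> P e ! j \<in> trace p \<longrightarrow> branch (trace p) = {} \<longrightarrow> T \<inter> set p \<noteq> {})"
proof -
  let ?r = "P e ! j"
  define A where "A = {v \<in> verts G. ?r \<in> \<Phi> v}"
  \<comment> \<open>Beyond the ends of the list the values do not matter: the segments used below
    stay strictly between \<open>k1\<close> and \<open>k2\<close>.\<close>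
  define D where "D = {\<lambda>k. P e ! (j + k), \<lambda>k. P e ! (j - k)}"
  have fA: "finite A" using simple_G by (simp add: A_def simple_graph_def)
  obtain T where T: "T \<subseteq> A" "card T \<le> card D"
    "\<And>v \<rho> i. v \<in> A \<Longrightarrow> \<rho> \<in> D \<Longrightarrow> \<rho> ` {..i::nat} \<subseteq> \<Phi> v \<Longrightarrow> \<exists>x\<in>T. \<rho> ` {..i} \<subseteq> \<Phi> x"
    using farthest_selection[OF fA, of D \<Phi>] by (auto simp: D_def)
  have "card D \<le> 2" unfolding D_def by (simp add: card_insert_if)
  moreover have "T \<inter> set p \<noteq> {}"
    if p: "longest_path G p" "?r \<in> trace p" "branch (trace p) = {}" for p
  proof -
    obtain v where v: "v \<in> set p" "?r \<in> \<Phi> v" using p by (auto simp: trace_def)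
    have vG: "v \<in> verts G" using v longest_verts p by blast
    have nb: "branch (\<Phi> v) = {}" using p(3) v(1) by (auto simp: branch_def trace_def)
    obtain h h' where h: "h \<in> e" "P e ! 0 = \<iota> h" "h' \<in> e" "P e ! (length (P e) - 1) = \<iota> h'"
      using P_first_last[OF e] .
    have ends: "P e ! 0 \<notin> \<Phi> v" "P e ! (length (P e) - 1) \<notin> \<Phi> v"
      using h nb edge_subset[OF e] by (auto simp: branch_def)
    obtain k1 k2 where k: "k2 < length (P e)" "\<Phi> v = (!) (P e) ` {k1<..<k2}"
      using \<Phi>_conn'(1)[OF vG] e j v(2)
    proof (cases rule: segment_cases)
      case right
      moreover have "length (P e) - 1 \<in> {j..<length (P e)}" using j by auto
      ultimately show ?thesis using ends by blast
    qed (use ends in blast)+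
    have dist: "distinct (P e)" using P_path[OF e] by (simp add: is_path_iff)
    obtain j' where "k1 < j'" "j' < k2" "P e ! j' = P e ! j" using k v(2) by auto
    hence jk: "k1 < j" "j < k2" using dist j k(1) by (auto simp: nth_eq_iff_index_eq)
    have "\<exists>x\<in>T. t \<in> \<Phi> x" if t: "t \<in> \<Phi> v" for t
    proof -
      obtain i where i: "k1 < i" "i < k2" "t = P e ! i" using t k by auto
      obtain \<rho> m where \<rho>: "\<rho> \<in> D" "\<rho> m = t" "\<rho> ` {..m} \<subseteq> \<Phi> v"
      proof (cases "j \<le> i")
        case True
        show ?thesis
          by (rule that[of "\<lambda>k. P e ! (j + k)" "i - j"]) (use True i jk k in \<open>auto simp: D_def\<close>)
      next
        case False
        have "P e ! (j - l) \<in> \<Phi> v" if "l \<le> j - i" for l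
        proof -
          have "j - l \<in> {k1<..<k2}" using that False i jk by auto
          thus ?thesis using k by blast
        qed
        thus ?thesis
          by (intro that[of "\<lambda>k. P e ! (j - k)" "j - i"]) (use False i in \<open>auto simp: D_def\<close>)
      qed
      then obtain x where "x \<in> T" "\<rho> ` {..m} \<subseteq> \<Phi> x" using T(3)[of v \<rho> m] v vG by (auto simp: A_def)
      thus ?thesis using \<rho>(2) by blast
    qed
    thus ?thesis using longest_path_hits[OF p(1) v] T(1) by (simp add: A_def)
  qed
  ultimately show ?thesis using T(1,2) by (intro exI[of _ T]) (auto simp: A_def)
qed

section \<open>The bound in the two cases\<close>

lemma lpt_le_if_all_branch:
  assumes br: "\<And>p. longest_path G p \<Longrightarrow> branch (trace p) \<noteq> {}"
  shows "lpt G \<le> (treewidth H + 1) * (2 * card (edges H))"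
proof -
  define F where "F = (\<lambda>p. branch (trace p)) ` {p. longest_path G p}"
  obtain K where K: "K \<subseteq> verts H" "card K \<le> treewidth H + 1" "\<And>X. X \<in> F \<Longrightarrow> X \<inter> K \<noteq> {}"
  proof (rule bramble_hitting_set[OF simple_H, of F])
    show "X \<subseteq> verts H \<and> X \<noteq> {} \<and> conn H X" if "X \<in> F" for X
      using that br branch_conn trace_conn by (auto simp: F_def branch_def)
    show "\<exists>x\<in>X. \<exists>y\<in>Y. x = y \<or> adj H x y" if XY: "X \<in> F" "Y \<in> F" for X Y
    proof -
      obtain p q where p: "longest_path G p" "X = branch (trace p)"
        and q: "longest_path G q" "Y = branch (trace q)" using XY by (auto simp: F_def)
      obtain z where "z \<in> trace p" "z \<in> trace q" "z \<in> verts S" using trace_meet[OF p(1) q(1)] .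
      thus ?thesis using branch_touch[of "trace p" "trace q" z] trace_conn br p q by simp
    qed
  qed blast
  obtain T where T: "\<And>h. h \<in> verts H \<Longrightarrow> T h \<subseteq> verts G \<and> card (T h) \<le> 2 * card (edges H) \<and>
    (\<forall>p. longest_path G p \<longrightarrow> \<iota> h \<in> trace p \<longrightarrow> T h \<inter> set p \<noteq> {})"
    using branch_selection by metis
  \<comment> \<open>Each branch vertex of the hitting set is replaced by its selection in
    \<open>G\<close>.\<close>
  have "lp_transversal G (\<Union>h\<in>K. T h)"
    unfolding lp_transversal_def
  proof (intro conjI allI impI)
    show "(\<Union>h\<in>K. T h) \<subseteq> verts G" using T K by blast
    fix p assume p: "longest_path G p"
    then obtain h where "h \<in> K" "h \<in> branch (trace p)" using K(3)[of "branch (trace p)"] by (auto simp: F_def)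
    thus "set p \<inter> (\<Union>h\<in>K. T h) \<noteq> {}" using T[of h] p by (auto simp: branch_def)
  qed
  hence "lpt G \<le> card (\<Union>h\<in>K. T h)" by (rule lpt_le_card)
  also have "\<dots> \<le> (\<Sum>h\<in>K. card (T h))"
    using K(1) simple_H by (intro card_UN_le) (auto simp: simple_graph_def intro: finite_subset)
  also have "\<dots> \<le> card K * (2 * card (edges H))"
    using sum_bounded_above[of K "\<lambda>h. card (T h)" "2 * card (edges H)"] T K(1) by auto
  also have "\<dots> \<le> (treewidth H + 1) * (2 * card (edges H))" using K(2) by (rule mult_right_mono) simp
  finally show ?thesis .
qed

text \<open>A longest path whose trace avoids all branch vertices confines the traces of all such paths to
  intervals of one subdivided edge. Pairwise intersecting intervals share the point just below the
  smallest right end, and every other longest path passes through an end of that edge.\<close>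

lemma lpt_le_if_not_all_branch:
  assumes q: "longest_path G q" "branch (trace q) = {}"
  shows "lpt G \<le> 4 * card (edges H) + 2"
proof -
  obtain z where z: "z \<in> trace q" "z \<in> verts S" using trace_meet[OF q(1) q(1)] .
  obtain e i where e: "e \<in> edges H" and i: "i < length (P e)" "z = P e ! i" using z(2) by (rule vertex_on_P)
  have dist: "distinct (P e)" using P_path[OF e] by (simp add: is_path_iff)
  obtain h h' where h: "h \<in> e" "P e ! 0 = \<iota> h" "h' \<in> e" "P e ! (length (P e) - 1) = \<iota> h'"
    using P_first_last[OF e] .
  \<comment> \<open>The other outcomes of \<open>segment_cases\<close> would put an end of
    \<open>P e\<close> into the trace.\<close>
  have segment: "\<exists>k1 k2. k2 < length (P e) \<and> trace p = (!) (P e) ` {k1<..<k2}"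
    if p: "longest_path G p" "branch (trace p) = {}" "m < length (P e)" "P e ! m \<in> trace p" for p m
  proof -
    have ends: "P e ! 0 \<notin> trace p" "P e ! (length (P e) - 1) \<notin> trace p"
      using h p(2) edge_subset[OF e] by (auto simp: branch_def)
    show ?thesis
      using trace_conn[OF p(1)] e p(3,4)
    proof (cases rule: segment_cases)
      case right
      moreover have "length (P e) - 1 \<in> {m..<length (P e)}" using p by auto
      ultimately show ?thesis using ends by blast
    qed (use ends in blast)+
  qed
  obtain a0 b0 where ab0: "b0 < length (P e)" "trace q = (!) (P e) ` {a0<..<b0}"
    using segment[OF q i(1)] z i by blast
  \<comment> \<open>Every trace meets that of \<open>q\<close>, which lies on
    \<open>P e\<close>.\<close>
  have on_e: "\<exists>m<length (P e). P e ! m \<in> trace p" if p: "longest_path G p" for p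
  proof -
    obtain y where "y \<in> trace p" "y \<in> trace q" using trace_meet[OF p q(1)] .
    then obtain m where "m < b0" "P e ! m \<in> trace p" using ab0(2) by auto
    thus ?thesis using ab0(1) by (meson less_trans)
  qed
  let ?R = "\<lambda>b. b < length (P e) \<and> (\<exists>p a. longest_path G p \<and> trace p = (!) (P e) ` {a<..<b})"
  define b where "b = (LEAST b. ?R b)"
  have "?R b0" using ab0 q(1) by (intro conjI exI)
  hence b: "?R b" unfolding b_def by (rule LeastI)
  have b_least: "b \<le> b'" if "?R b'" for b' unfolding b_def using that by (rule Least_le)
  obtain q' a where q': "longest_path G q'" "trace q' = (!) (P e) ` {a<..<b}" using b by (elim conjE exE)
  \<comment> \<open>The intervals are open, so b - 1 is the last position of the trace of
    \<open>q'\<close>.\<close>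
  define j where "j = b - 1"
  have common: "P e ! j \<in> trace p" if p: "longest_path G p" "branch (trace p) = {}" for p
  proof -
    obtain a' b' where ab': "b' < length (P e)" "trace p = (!) (P e) ` {a'<..<b'}"
      using segment[OF p] on_e[OF p(1)] by blast
    obtain y where "y \<in> trace p" "y \<in> trace q'" using trace_meet[OF p(1) q'(1)] .
    then obtain m m' where m: "a < m" "m < b" "a' < m'" "m' < b'" "P e ! m = P e ! m'"
      using ab' q' by auto
    hence "m = m'" using dist b ab' by (auto simp: nth_eq_iff_index_eq)
    moreover have "b \<le> b'" by (rule b_least) (use ab' p(1) in \<open>intro conjI exI\<close>)
    \<comment> \<open>The common position m satisfies a' < m \<le> b - 1, and b - 1 < b \<le>
      b'.\<close>
    ultimately have "j \<in> {a'<..<b'}" using m by (auto simp: j_def)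
    thus ?thesis using ab' by blast
  qed
  have j: "j < length (P e)" using b by (auto simp: j_def)
  have hv: "h \<in> verts H" "h' \<in> verts H" using h edge_subset[OF e] by auto
  obtain T where T: "T \<subseteq> verts G" "card T \<le> 2 * card (edges H)"
    "\<And>p. longest_path G p \<Longrightarrow> \<iota> h \<in> trace p \<Longrightarrow> T \<inter> set p \<noteq> {}"
    using branch_selection[OF hv(1)] by blast
  obtain T' where T': "T' \<subseteq> verts G" "card T' \<le> 2 * card (edges H)"
    "\<And>p. longest_path G p \<Longrightarrow> \<iota> h' \<in> trace p \<Longrightarrow> T' \<inter> set p \<noteq> {}"
    using branch_selection[OF hv(2)] by blast
  obtain U where U: "U \<subseteq> verts G" "card U \<le> 2"
    "\<And>p. longest_path G p \<Longrightarrow> P e ! j \<in> trace p \<Longrightarrow> branch (trace p) = {} \<Longrightarrow> U \<inter> set p \<noteq> {}"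
    using inner_selection[OF e j] by blast
  have e_eq: "e = {h, h'}"
  proof -
    have "P e ! 0 \<noteq> P e ! (length (P e) - 1)"
      using dist P_len[OF e] by (subst nth_eq_iff_index_eq) auto
    hence "h \<noteq> h'" using h by auto
    thus ?thesis using h e simple_H by (auto simp: simple_graph_def)
  qed
  have "lp_transversal G (T \<union> T' \<union> U)"
    unfolding lp_transversal_def
  proof (intro conjI allI impI)
    show "T \<union> T' \<union> U \<subseteq> verts G" using T T' U by blast
    fix p assume p: "longest_path G p"
    show "set p \<inter> (T \<union> T' \<union> U) \<noteq> {}"
    proof (cases "branch (trace p) = {}")
      case True
      then show ?thesis using U(3)[OF p common[OF p]] by blast
    next
      case False
      have "\<iota> h \<in> trace p \<or> \<iota> h' \<in> trace p"
        using contains_end[OF trace_conn[OF p] False e] on_e[OF p] e_eq by blast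
      then show ?thesis using T(3)[OF p] T'(3)[OF p] by blast
    qed
  qed
  hence "lpt G \<le> card (T \<union> T' \<union> U)" by (rule lpt_le_card)
  also have "\<dots> \<le> card T + card T' + card U"
    using card_Un_le[of "T \<union> T'" U] card_Un_le[of T T'] by linarith
  finally show ?thesis using T(2) T'(2) U(2) by linarith
qed

text \<open>The second case dictates the constant 4: its additive 2 is absorbed because
  \<open>H\<close> has an edge.\<close>

lemma lpt_bound: "lpt G \<le> 4 * (treewidth H + 1) * card (edges H)"
proof (cases "\<forall>p. longest_path G p \<longrightarrow> branch (trace p) \<noteq> {}")
  case True
  hence "lpt G \<le> (treewidth H + 1) * (2 * card (edges H))" by (intro lpt_le_if_all_branch) blast
  also have "\<dots> \<le> 4 * (treewidth H + 1) * card (edges H)" by (simp add: algebra_simps)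
  finally show ?thesis .
next
  case False
  then obtain q where "longest_path G q" "branch (trace q) = {}" by blast
  hence le: "lpt G \<le> 4 * card (edges H) + 2" by (rule lpt_le_if_not_all_branch)
  have "verts H \<noteq> {}" using card_H by auto
  then obtain e where e: "e \<in> edges H" using vertex_in_edge by blast
  hence "card (edges H) \<ge> 1" using finite_edges by (metis One_nat_def Suc_leI card_gt_0_iff empty_iff)
  hence "lpt G \<le> 4 * 2 * card (edges H)" using le by linarith
  also have "\<dots> \<le> 4 * (treewidth H + 1) * card (edges H)"
    using treewidth_ge_1[OF simple_H e] by (intro mult_right_mono) auto
  finally show ?thesis .
qed

end

theorem theorem4p2:
  fixes H :: "'h graph" and G :: "'a graph"
  assumes "simple_graph H" and "connected H" and "card (verts H) \<ge> 2"
    and "simple_graph G" and "connected G" and "is_H_graph G H"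
  shows "lpt G \<le> 4 * (treewidth H + 1) * card (edges H)"
proof -
  obtain S \<Phi> where S: "subdivision_of S H"
    and \<Phi>: "\<forall>v\<in>verts G. \<Phi> v \<subseteq> verts S \<and> connected (induced S (\<Phi> v))"
      "\<forall>u\<in>verts G. \<forall>v\<in>verts G. u \<noteq> v \<longrightarrow> ({u, v} \<in> edges G \<longleftrightarrow> \<Phi> u \<inter> \<Phi> v \<noteq> {})"
    using assms(6) unfolding is_H_graph_def by blast
  obtain \<iota> P where P: "inj_on \<iota> (verts H)"
    "\<forall>e\<in>edges H. is_path S (P e) \<and> length (P e) \<ge> 2 \<and>
        {hd (P e), last (P e)} = \<iota> ` e \<and> interior (P e) \<inter> \<iota> ` verts H = {}"
    "\<forall>e\<in>edges H. \<forall>f\<in>edges H. e \<noteq> f \<longrightarrow> interior (P e) \<inter> interior (P f) = {}"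
    "verts S = \<iota> ` verts H \<union> (\<Union>e\<in>edges H. set (P e))"
    "edges S = (\<Union>e\<in>edges H. path_edges (P e))"
    using S unfolding subdivision_of_def by (elim conjE exE)
  interpret represented S H \<iota> P G \<Phi>
    by unfold_locales (use assms(1-5) P \<Phi> in simp_all)
  show ?thesis by (rule lpt_bound)
qed

end
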